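(* There exists a Hausdorff space $X$ such that $X$ is an $\omega$-space and $t_k(X)=t_{k_1}(X)=t^{\ast}_k(X)=t(X)=\omega$.
   Context: All spaces are Hausdorff; countable means at most countable. A space $X$ is an $\omega$-space if a subset $A$ is closed in $X$ if and only if $A\cap P$ is closed in $P$ for every countable subspace $P\subseteq X$. For an infinite cardinal $\tau$, a set $B\subseteq X$ is called $\tau$-compact if $B=\bigcup\{B_\alpha:\alpha\in\tau\}$ where each $B_\alpha$ is a compact subset of $X$. Define: $t_k(X)\le\tau$ if and only if for every $A\subseteq X$ that is not closed there exists a $\tau$-compact $B\subseteq X$ for which $A\cap B$ is not closed in $X$; $t_{k_1}(X)\le\tau$ if and only if for every $A\subseteq X$ and every $x\in\overline{A}$ there exists a $\tau$-compact $B\subseteq X$ such that $x\in\overline{A\cap B}$; $t^{\ast}_k(X)\le\tau$ if and only if for every $A\subseteq X$ and every $x\in\overline{A}$ there exists a $\tau$-compact $B\subseteq A$ such that $x\in\overline{B}$. The tightness satisfies $t(X)\le\tau$ if and only if for every $A\subseteq X$ and every $x\in\overline{A}$ there exists $B\subseteq A$ with $|B|\le\tau$ and $x\in\overline{B}$. The value of each of these functions is the smallest infinite cardinal $\tau$ for which the inequality holds; $\omega$ is the smallest infinite cardinal. *)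

theory Defs
  imports "HOL-Analysis.Analysis"
begin

unbundle cardinal_syntax
no_notation elt_set_eq (infix "=o" 50)

definition omega_space :: "'a topology \<Rightarrow> bool" where
  "omega_space X \<longleftrightarrow>
     (\<forall>A \<subseteq> topspace X.
        closedin X A \<longleftrightarrow>
        (\<forall>P \<subseteq> topspace X. countable P \<longrightarrow> closedin (subtopology X P) (A \<inter> P)))"

(* Cardinals are represented, as in the BNF cardinal library, by minimal well-orders r;
   the elements of the cardinal r are the elements of Field r, and omega is natLeq. *)

definition tau_compact :: "'a topology \<Rightarrow> 'b rel \<Rightarrow> 'a set \<Rightarrow> bool" where
  "tau_compact X \<tau> B \<longleftrightarrow>
     (\<exists>K. (\<forall>\<alpha>\<in>Field \<tau>. compactin X (K \<alpha>)) \<and> B = (\<Union>\<alpha>\<in>Field \<tau>. K \<alpha>))"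

definition t_k_le :: "'a topology \<Rightarrow> 'b rel \<Rightarrow> bool" where
  "t_k_le X \<tau> \<longleftrightarrow>
     (\<forall>A \<subseteq> topspace X. \<not> closedin X A \<longrightarrow>
        (\<exists>B \<subseteq> topspace X. tau_compact X \<tau> B \<and> \<not> closedin X (A \<inter> B)))"

definition t_k1_le :: "'a topology \<Rightarrow> 'b rel \<Rightarrow> bool" where
  "t_k1_le X \<tau> \<longleftrightarrow>
     (\<forall>A \<subseteq> topspace X. \<forall>x \<in> X closure_of A.
        \<exists>B \<subseteq> topspace X. tau_compact X \<tau> B \<and> x \<in> X closure_of (A \<inter> B))"

definition t_kstar_le :: "'a topology \<Rightarrow> 'b rel \<Rightarrow> bool" where
  "t_kstar_le X \<tau> \<longleftrightarrow>
     (\<forall>A \<subseteq> topspace X. \<forall>x \<in> X closure_of A.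
        \<exists>B \<subseteq> A. tau_compact X \<tau> B \<and> x \<in> X closure_of B)"

definition tightness_le :: "'a topology \<Rightarrow> 'b rel \<Rightarrow> bool" where
  "tightness_le X \<tau> \<longleftrightarrow>
     (\<forall>A \<subseteq> topspace X. \<forall>x \<in> X closure_of A.
        \<exists>B \<subseteq> A. |B| \<le>o \<tau> \<and> x \<in> X closure_of B)"

(* The smallest infinite cardinal satisfying P. A cardinal is only determined up to =o,
   so some well-order of minimal type is chosen. *)

definition least_inf_card :: "('b rel \<Rightarrow> bool) \<Rightarrow> 'b rel" where
  "least_inf_card P =
     (SOME \<tau>. Cinfinite \<tau> \<and> P \<tau> \<and> (\<forall>\<sigma>. Cinfinite \<sigma> \<and> P \<sigma> \<longrightarrow> \<tau> \<le>o \<sigma>))"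

(* The type 'a + nat carries omega as well as every cardinal up to that of the space, which
   suffices for all four functions: the lemmas *_ordLeq_iff below compare the values with
   infinite cardinals on arbitrary types. *)

definition t_k :: "'a topology \<Rightarrow> ('a + nat) rel" where
  "t_k X = least_inf_card (t_k_le X)"

definition t_k1 :: "'a topology \<Rightarrow> ('a + nat) rel" where
  "t_k1 X = least_inf_card (t_k1_le X)"

definition t_kstar :: "'a topology \<Rightarrow> ('a + nat) rel" where
  "t_kstar X = least_inf_card (t_kstar_le X)"

definition tightness :: "'a topology \<Rightarrow> ('a + nat) rel" where
  "tightness X = least_inf_card (tightness_le X)"

lemma least_inf_card:
  assumes "Cinfinite \<rho>" "P \<rho>"
  shows "Cinfinite (least_inf_card P) \<and> P (least_inf_card P) \<and>
         (\<forall>\<sigma>. Cinfinite \<sigma> \<and> P \<sigma> \<longrightarrow> least_inf_card P \<le>o \<sigma>)"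
proof -
  obtain \<tau> where \<tau>: "Cinfinite \<tau> \<and> P \<tau>"
    and min: "\<And>\<sigma>. \<sigma> <o \<tau> \<Longrightarrow> \<not> (Cinfinite \<sigma> \<and> P \<sigma>)"
    using wfE_min[OF wf_ordLess, of \<rho> "{\<sigma>. Cinfinite \<sigma> \<and> P \<sigma>}"] assms
    by (metis (mono_tags, lifting) mem_Collect_eq)
  have "\<tau> \<le>o \<sigma>" if "Cinfinite \<sigma> \<and> P \<sigma>" for \<sigma>
    using min[of \<sigma>] that \<tau> not_ordLess_iff_ordLeq by (metis card_order_on_well_order_on)
  with \<tau> show ?thesis
    unfolding least_inf_card_def by (intro someI_ex[of "\<lambda>\<tau>. Cinfinite \<tau> \<and> P \<tau> \<and> _ \<tau>"]) blast
qed

lemma value_bound: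
  fixes X :: "'a topology"
  defines "\<kappa> \<equiv> |Inl ` topspace X \<union> range (Inr :: nat \<Rightarrow> 'a + nat)|"
  shows "Cinfinite \<kappa>" "t_k_le X \<kappa>" "t_k1_le X \<kappa>" "t_kstar_le X \<kappa>" "tightness_le X \<kappa>"
proof -
  show "Cinfinite \<kappa>"
    unfolding \<kappa>_def cinfinite_def
    using card_of_Card_order by (auto simp: Field_card_of finite_image_iff)
  have tc: "tau_compact X \<kappa> B" if "B \<subseteq> topspace X" for B
  proof -
    let ?K = "\<lambda>z. case z of Inl x \<Rightarrow> {x} \<inter> B | Inr n \<Rightarrow> {}"
    have "compactin X ({x} \<inter> B)" for x
      using that by (intro finite_imp_compactin) auto
    then have "\<forall>\<alpha>\<in>Field \<kappa>. compactin X (?K \<alpha>)"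
      by (auto split: sum.split)
    moreover have "B = (\<Union>\<alpha>\<in>Field \<kappa>. ?K \<alpha>)"
      using that by (auto simp: \<kappa>_def Field_card_of split: sum.splits)
    ultimately show ?thesis unfolding tau_compact_def by blast
  qed
  show "t_k_le X \<kappa>"
    unfolding t_k_le_def by (metis tc inf.idem)
  show "t_k1_le X \<kappa>"
    unfolding t_k1_le_def by (metis tc inf.idem)
  show "t_kstar_le X \<kappa>"
    unfolding t_kstar_le_def by (metis tc order_refl)
  have "|A| \<le>o \<kappa>" if "A \<subseteq> topspace X" for A
    unfolding \<kappa>_def card_of_ordLeq[symmetric] using that
    by (intro exI[of _ Inl]) auto
  then show "tightness_le X \<kappa>"
    unfolding tightness_le_def by blast
qed

lemma tau_compact_mono:
  assumes "tau_compact X \<rho> B" "\<rho> \<le>o \<sigma>" "Card_order \<rho>" "Card_order \<sigma>"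
  shows "tau_compact X \<sigma> B"
proof -
  obtain K where K: "\<forall>\<alpha>\<in>Field \<rho>. compactin X (K \<alpha>)" "B = (\<Union>\<alpha>\<in>Field \<rho>. K \<alpha>)"
    using assms(1) unfolding tau_compact_def by blast
  have "|Field \<rho>| \<le>o |Field \<sigma>|"
    using assms(2) by (simp add: card_of_mono2)
  then obtain f where f: "inj_on f (Field \<rho>)" "f ` Field \<rho> \<subseteq> Field \<sigma>"
    unfolding card_of_ordLeq[symmetric] by blast
  define K' where "K' \<beta> = (if \<beta> \<in> f ` Field \<rho> then K (inv_into (Field \<rho>) f \<beta>) else {})" for \<beta>
  have "compactin X (K' \<beta>)" for \<beta>
  proof (cases "\<beta> \<in> f ` Field \<rho>")
    case True
    then have "inv_into (Field \<rho>) f \<beta> \<in> Field \<rho>" by (rule inv_into_into)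
    then show ?thesis using K(1) True by (simp add: K'_def)
  qed (simp add: K'_def)
  moreover have "B = (\<Union>\<beta>\<in>Field \<sigma>. K' \<beta>)"
  proof -
    have "(\<Union>\<beta>\<in>Field \<sigma>. K' \<beta>) = (\<Union>\<beta>\<in>f ` Field \<rho>. K' \<beta>)"
      using f(2) by (intro equalityI subsetI) (auto simp only: K'_def UN_iff split: if_splits)
    also have "\<dots> = (\<Union>\<alpha>\<in>Field \<rho>. K \<alpha>)"
      using f(1) by (simp add: K'_def)
    finally show ?thesis using K(2) by simp
  qed
  ultimately show ?thesis unfolding tau_compact_def by (intro exI[of _ K'] conjI ballI)
qed

lemma t_k_le_mono:
  "\<lbrakk>t_k_le X \<rho>; \<rho> \<le>o \<sigma>; Card_order \<rho>; Card_order \<sigma>\<rbrakk> \<Longrightarrow> t_k_le X \<sigma>"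
  unfolding t_k_le_def Ball_def
  by (elim all_forward imp_forward ex_forward conj_forward) (auto intro: tau_compact_mono)

lemma t_k1_le_mono:
  "\<lbrakk>t_k1_le X \<rho>; \<rho> \<le>o \<sigma>; Card_order \<rho>; Card_order \<sigma>\<rbrakk> \<Longrightarrow> t_k1_le X \<sigma>"
  unfolding t_k1_le_def Ball_def
  by (elim all_forward imp_forward ex_forward conj_forward) (auto intro: tau_compact_mono)

lemma t_kstar_le_mono:
  "\<lbrakk>t_kstar_le X \<rho>; \<rho> \<le>o \<sigma>; Card_order \<rho>; Card_order \<sigma>\<rbrakk> \<Longrightarrow> t_kstar_le X \<sigma>"
  unfolding t_kstar_le_def Ball_def
  by (elim all_forward imp_forward ex_forward conj_forward) (auto intro: tau_compact_mono)

lemma tightness_le_mono: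
  "\<lbrakk>tightness_le X \<rho>; \<rho> \<le>o \<sigma>; Card_order \<rho>; Card_order \<sigma>\<rbrakk> \<Longrightarrow> tightness_le X \<sigma>"
  unfolding tightness_le_def Ball_def
  by (elim all_forward imp_forward ex_forward conj_forward) (auto intro: ordLeq_transitive)

lemma least_inf_card_ordLeq_iff:
  fixes P :: "'b rel \<Rightarrow> bool" and Q :: "'c rel \<Rightarrow> bool"
  assumes \<kappa>: "Cinfinite \<kappa>" "P \<kappa>"
    and PQ: "\<And>\<rho> \<sigma>. \<lbrakk>P \<rho>; \<rho> \<le>o \<sigma>; Card_order \<rho>; Card_order \<sigma>\<rbrakk> \<Longrightarrow> Q \<sigma>"
    and QP: "\<And>\<rho> \<sigma>. \<lbrakk>Q \<rho>; \<rho> \<le>o \<sigma>; Card_order \<rho>; Card_order \<sigma>\<rbrakk> \<Longrightarrow> P \<sigma>"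
    and \<sigma>: "Cinfinite \<sigma>"
  shows "least_inf_card P \<le>o \<sigma> \<longleftrightarrow> Q \<sigma>"
proof
  note least = least_inf_card[of \<kappa> P, OF \<kappa>]
  show "Q \<sigma>" if "least_inf_card P \<le>o \<sigma>"
    using PQ[OF _ that] least \<sigma> by blast
  show "least_inf_card P \<le>o \<sigma>" if "Q \<sigma>"
  proof (cases "\<kappa> \<le>o \<sigma>")
    case True
    then show ?thesis using least \<kappa> ordLeq_transitive[OF _ True] by blast
  next
    case False
    then have "\<sigma> \<le>o \<kappa>"
      using \<sigma> \<kappa>(1) ordLeq_total by (metis card_order_on_well_order_on)
    then have "|Field \<sigma>| \<le>o |Field \<kappa>|" by (simp add: card_of_mono2)
    then obtain C :: "'b set" where "|Field \<sigma>| =o |C|"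
      using internalize_card_of_ordLeq2[THEN iffD1] by metis
    then have C: "\<sigma> =o |C|"
      using \<sigma> ordIso_transitive[OF ordIso_symmetric[OF card_of_Field_ordIso]] by blast
    then have "P |C|"
      using QP[OF that ordIso_imp_ordLeq[OF C]] \<sigma> card_of_Card_order by blast
    moreover have "Cinfinite |C|" using Cinfinite_cong[OF C \<sigma>] .
    ultimately have "least_inf_card P \<le>o |C|" using least by blast
    then show ?thesis using ordLeq_ordIso_trans[OF _ ordIso_symmetric[OF C]] by blast
  qed
qed

lemma t_k_ordLeq_iff: "Cinfinite \<sigma> \<Longrightarrow> t_k X \<le>o \<sigma> \<longleftrightarrow> t_k_le X \<sigma>"
  unfolding t_k_def
  by (rule least_inf_card_ordLeq_iff)
    (rule value_bound(1), rule value_bound(2), (erule (3) t_k_le_mono)+)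

lemma t_k1_ordLeq_iff: "Cinfinite \<sigma> \<Longrightarrow> t_k1 X \<le>o \<sigma> \<longleftrightarrow> t_k1_le X \<sigma>"
  unfolding t_k1_def
  by (rule least_inf_card_ordLeq_iff)
    (rule value_bound(1), rule value_bound(3), (erule (3) t_k1_le_mono)+)

lemma t_kstar_ordLeq_iff: "Cinfinite \<sigma> \<Longrightarrow> t_kstar X \<le>o \<sigma> \<longleftrightarrow> t_kstar_le X \<sigma>"
  unfolding t_kstar_def
  by (rule least_inf_card_ordLeq_iff)
    (rule value_bound(1), rule value_bound(4), (erule (3) t_kstar_le_mono)+)

lemma tightness_ordLeq_iff: "Cinfinite \<sigma> \<Longrightarrow> tightness X \<le>o \<sigma> \<longleftrightarrow> tightness_le X \<sigma>"
  unfolding tightness_def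
  by (rule least_inf_card_ordLeq_iff)
    (rule value_bound(1), rule value_bound(5), (erule (3) tightness_le_mono)+)

end

theory Submission
  imports Defs
begin

text \<open>
  The witness is the real line with its usual topology. What makes it work is that the line is
  first countable, so every point of a closure is the limit of a sequence, and the range of that
  sequence is a countable set witnessing countable tightness (\<open>tightness_le_natLeq_euclidean\<close>).

  Countable tightness dominates all the other properties. A countable set is a countable union of
  singletons, hence \<open>\<omega>\<close>-compact, so the witnesses for countable tightness also bound
  \<open>t\<^sup>*\<^sub>k\<close> and with it \<open>t\<^sub>k\<^sub>1\<close> and \<open>t\<^sub>k\<close>. For the \<open>\<omega>\<close>-space property, adjoin a limit
  point \<open>x\<close> of \<open>A\<close> to a countable subset of \<open>A\<close> accumulating at \<open>x\<close>: on this countable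
  subspace \<open>A\<close> can only be closed if it contains \<open>x\<close>. The values are then exactly \<open>\<omega>\<close>
  because they are infinite by definition.
\<close>

lemma card_of_ordLeq_natLeq_iff: "|B| \<le>o natLeq \<longleftrightarrow> countable B"
proof -
  have "|B| \<le>o natLeq \<longleftrightarrow> |B| \<le>o |UNIV :: nat set|"
    using card_of_nat ordIso_symmetric ordLeq_ordIso_trans by blast
  also have "\<dots> \<longleftrightarrow> countable B"
    by (simp add: card_of_ordLeq[symmetric] countable_def)
  finally show ?thesis .
qed

lemma tightness_le_natLeqE:
  assumes "tightness_le X natLeq" "A \<subseteq> topspace X" "x \<in> X closure_of A"
  obtains B where "B \<subseteq> A" "countable B" "x \<in> X closure_of B"
  using assms unfolding tightness_le_def card_of_ordLeq_natLeq_iff by blast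

lemma tau_compact_countable:
  assumes "countable B" "B \<subseteq> topspace X"
  shows "tau_compact X natLeq B"
proof -
  \<comment> \<open>If \<open>B\<close> is empty, \<open>from_nat_into B n\<close> is an arbitrary point; intersecting with \<open>B\<close> discards it.\<close>
  let ?K = "\<lambda>n. {from_nat_into B n} \<inter> B"
  have "compactin X (?K n)" for n
    using assms(2) by (intro finite_imp_compactin) auto
  moreover have "B = (\<Union>n. ?K n)"
    using from_nat_into_surj[OF assms(1)] by fastforce
  ultimately show ?thesis
    unfolding tau_compact_def Field_natLeq by (intro exI[of _ ?K]) simp
qed

lemma t_kstar_le_if_tightness_le:
  assumes "tightness_le X natLeq"
  shows "t_kstar_le X natLeq"
  unfolding t_kstar_le_def
proof (intro allI impI ballI)
  fix A x assume "A \<subseteq> topspace X" "x \<in> X closure_of A"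
  then show "\<exists>B\<subseteq>A. tau_compact X natLeq B \<and> x \<in> X closure_of B"
    by (metis assms tightness_le_natLeqE tau_compact_countable order_trans)
qed

lemma t_k1_le_if_t_kstar_le:
  assumes "t_kstar_le X \<tau>"
  shows "t_k1_le X \<tau>"
  using assms unfolding t_k1_le_def t_kstar_le_def by (metis inf.absorb2 order_trans)

text \<open>
  If \<open>x\<close> lies in the closure of \<open>A\<close> but not in \<open>A\<close>, and \<open>B\<close> keeps \<open>x\<close> in the closure of
  \<open>A \<inter> B\<close>, then \<open>x\<close> also shows that \<open>A \<inter> B\<close> is not closed.
\<close>

lemma t_k_le_if_t_k1_le:
  assumes "t_k1_le X \<tau>"
  shows "t_k_le X \<tau>"
  unfolding t_k_le_def
proof (intro allI impI)
  fix A assume A: "A \<subseteq> topspace X" "\<not> closedin X A"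
  then obtain x where x: "x \<in> X closure_of A" "x \<notin> A"
    using closure_of_subset_eq by blast
  then obtain B where B: "B \<subseteq> topspace X" "tau_compact X \<tau> B" "x \<in> X closure_of (A \<inter> B)"
    using assms A(1) unfolding t_k1_le_def by blast
  then have "\<not> closedin X (A \<inter> B)"
    using x(2) closure_of_closedin by (metis IntD1)
  with B show "\<exists>B\<subseteq>topspace X. tau_compact X \<tau> B \<and> \<not> closedin X (A \<inter> B)"
    by blast
qed

lemma omega_space_if_tightness_le:
  assumes "tightness_le X natLeq"
  shows "omega_space X"
  unfolding omega_space_def
proof (intro allI impI iffI)
  fix A P assume "closedin X A"
  then show "closedin (subtopology X P) (A \<inter> P)"
    by (auto simp: closedin_subtopology)
next
  fix A assume A: "A \<subseteq> topspace X"
    and P: "\<forall>P\<subseteq>topspace X. countable P \<longrightarrow> closedin (subtopology X P) (A \<inter> P)"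
  have "x \<in> A" if x: "x \<in> X closure_of A" for x
  proof -
    obtain B where B: "B \<subseteq> A" "countable B" "x \<in> X closure_of B"
      using tightness_le_natLeqE[OF assms A x] .
    have "x \<in> topspace X"
      using x by (simp add: in_closure_of)
    then have "closedin (subtopology X (insert x B)) (A \<inter> insert x B)"
      using P A B by simp
    then obtain C where C: "closedin X C" "A \<inter> insert x B = C \<inter> insert x B"
      by (auto simp: closedin_subtopology)
    have "B \<subseteq> C"
      using B(1) C(2) by blast
    then have "x \<in> C"
      using B(3) C(1) closure_of_minimal by blast
    with C(2) show "x \<in> A" by blast
  qed
  then show "closedin X A"
    using A closure_of_subset_eq by blast
qed

lemma tightness_le_natLeq_euclidean:
  "tightness_le (euclidean :: 'a::first_countable_topology topology) natLeq"
  unfolding tightness_le_def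
proof (intro allI impI ballI)
  fix A :: "'a set" and x assume "x \<in> euclidean closure_of A"
  then obtain s where s: "\<And>n. s n \<in> A" "s \<longlonglongrightarrow> x"
    by (auto simp: closure_sequential)
  then have "x \<in> closure (range s)"
    unfolding closure_sequential by blast
  moreover have "|range s| \<le>o natLeq"
    by (simp add: card_of_ordLeq_natLeq_iff)
  ultimately show "\<exists>B\<subseteq>A. |B| \<le>o natLeq \<and> x \<in> euclidean closure_of B"
    using s(1) by (intro exI[of _ "range s"]) auto
qed

lemma natLeq_ordLeq_values:
  "natLeq \<le>o t_k X" "natLeq \<le>o t_k1 X" "natLeq \<le>o t_kstar X" "natLeq \<le>o tightness X"
  unfolding t_k_def t_k1_def t_kstar_def tightness_def
  using value_bound[of X] least_inf_card natLeq_ordLeq_cinfinite by blast+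

lemma values_eq_natLeq_if_tightness_le:
  assumes "tightness_le X natLeq"
  shows "t_k X =o natLeq" "t_k1 X =o natLeq" "t_kstar X =o natLeq" "tightness X =o natLeq"
proof -
  have kstar: "t_kstar_le X natLeq"
    using assms by (rule t_kstar_le_if_tightness_le)
  then have k1: "t_k1_le X natLeq"
    by (rule t_k1_le_if_t_kstar_le)
  then have k: "t_k_le X natLeq"
    by (rule t_k_le_if_t_k1_le)
  note bounds = natLeq_ordLeq_values[of X] natLeq_Cinfinite
  show "t_k X =o natLeq" "t_k1 X =o natLeq" "t_kstar X =o natLeq" "tightness X =o natLeq"
    using k k1 kstar assms bounds
    by (simp_all add: ordIso_iff_ordLeq t_k_ordLeq_iff t_k1_ordLeq_iff t_kstar_ordLeq_iff
        tightness_ordLeq_iff)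
qed

theorem theorem1:
  shows "\<exists>X :: real topology.
           Hausdorff_space X \<and> omega_space X \<and>
           t_k X =o natLeq \<and> t_k1 X =o natLeq \<and> t_kstar X =o natLeq \<and> tightness X =o natLeq"
  using tightness_le_natLeq_euclidean[where 'a = real] Hausdorff_space_euclidean
    omega_space_if_tightness_le values_eq_natLeq_if_tightness_le by blast

end
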